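(* Let $D$ be an n-atomic domain. Then the following are equivalent: (1) $D$ is an n-UFD. (2) $S(a)\ast S(b)=S(ab)$ for every $a,b\in D^{\#}$.
   Context: A domain is an associative ring with identity, not necessarily commutative, without zero divisors. $U(D)$ is the group of units, $D^{*}=D\setminus\{0\}$, $D^{\#}=D^{*}\setminus U(D)$. An element is irreducible if it is a nonzero nonunit that is not a product of two nonunits; $Irr(D)$ is the set of irreducible elements, and $\overline{Irr}(D)$ is a fixed set of representatives, one from each coset in $\{aU(D):a\in Irr(D)\}$. $a\mid b$ means $b=cad$ for some $c,d\in D$. Elements $a,b$ are associated if $a=vbu$ with $u,v\in U(D)$. An element $a$ is normal if $aD=Da$. $D$ is n-atomic if every $r\in D^{\#}$ is a product of normal irreducible elements. $D$ is an n-UFD if it is n-atomic and, whenever $r_1\cdots r_l=t_1\cdots t_m$ is an element of $D^{\#}$ with all $r_i,t_j$ normal irreducible, then $l=m$ and there is a permutation $\sigma\in S_l$ with $r_i$ associated with $t_{\sigma(i)}$ for all $i$. For $x\in D^{\#}$, the irreducible divisor simplicial complex $S(x)$ is the pair $(V,F)$ with vertex set $V=\{y\in\overline{Irr}(D):y\mid x\}$ and face set $F$ consisting of $\emptyset$ and all sets $\{y_1,\dots,y_n\}$ of distinct vertices such that $y_{\sigma(1)}y_{\sigma(2)}\cdots y_{\sigma(n)}\mid x$ for some permutation $\sigma\in S_n$. Loops are ignored: equality of complexes means equality of vertex sets and of face sets. For $S=(V,F)$ and $T=(W,G)$, the join $S\ast T$ has vertex set $V\cup W$ and face set $\{A\cup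 B:A\in F,\ B\in G\}$. *)

theory Defs
  imports Main "HOL-Combinatorics.Permutations"
begin

text \<open>
  Domains are types of class \<open>ring_1_no_zero_divisors\<close>: associative, unital, nontrivial rings
  without zero divisors, not assumed commutative.  The library notions \<open>dvd\<close>, \<open>is_unit\<close> and
  \<open>irreducible\<close> are one-sided or require commutativity, hence the definitions below.
\<close>

definition unit_group :: "'a::ring_1_no_zero_divisors set" where
  "unit_group = {u. \<exists>v. u * v = 1 \<and> v * u = 1}"

definition nonzero_nonunits :: "'a::ring_1_no_zero_divisors set" where
  "nonzero_nonunits = (UNIV - {0}) - unit_group"

definition irreducibles :: "'a::ring_1_no_zero_divisors set" where
  "irreducibles =
     {a. a \<in> nonzero_nonunits \<and>
         \<not> (\<exists>b c. b \<notin> unit_group \<and> c \<notin> unit_group \<and> a = b * c)}"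

definition divides :: "'a::ring_1_no_zero_divisors \<Rightarrow> 'a \<Rightarrow> bool" where
  "divides a b \<longleftrightarrow> (\<exists>c d. b = c * a * d)"

definition associates :: "'a::ring_1_no_zero_divisors \<Rightarrow> 'a \<Rightarrow> bool" where
  "associates a b \<longleftrightarrow> (\<exists>u\<in>unit_group. \<exists>v\<in>unit_group. a = v * b * u)"

definition normal_element :: "'a::ring_1_no_zero_divisors \<Rightarrow> bool" where
  "normal_element a \<longleftrightarrow> range (\<lambda>d. a * d) = range (\<lambda>d. d * a)"

definition normal_irreducibles :: "'a::ring_1_no_zero_divisors set" where
  "normal_irreducibles = {a \<in> irreducibles. normal_element a}"

definition n_atomic :: "'a::ring_1_no_zero_divisors itself \<Rightarrow> bool" where
  "n_atomic _ \<longleftrightarrow>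
     (\<forall>r\<in>(nonzero_nonunits :: 'a set).
        \<exists>rs. set rs \<subseteq> normal_irreducibles \<and> r = prod_list rs)"

definition n_UFD :: "'a::ring_1_no_zero_divisors itself \<Rightarrow> bool" where
  "n_UFD D \<longleftrightarrow>
     n_atomic D \<and>
     (\<forall>rs ts :: 'a list.
        set rs \<subseteq> normal_irreducibles \<longrightarrow> set ts \<subseteq> normal_irreducibles \<longrightarrow>
        prod_list rs = prod_list ts \<longrightarrow> prod_list rs \<in> nonzero_nonunits \<longrightarrow>
        length rs = length ts \<and>
        (\<exists>\<sigma>. \<sigma> permutes {..<length rs} \<and>
             (\<forall>i<length rs. associates (rs ! i) (ts ! \<sigma> i))))"

definition irreducible_cosets :: "'a::ring_1_no_zero_divisors set set" where
  "irreducible_cosets = (\<lambda>a. (\<lambda>u. a * u) ` unit_group) ` irreducibles"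

definition irreducible_representatives :: "'a::ring_1_no_zero_divisors set \<Rightarrow> bool" where
  "irreducible_representatives R \<longleftrightarrow>
     R \<subseteq> \<Union> irreducible_cosets \<and> (\<forall>C\<in>irreducible_cosets. \<exists>!r. r \<in> R \<inter> C)"

text \<open>A complex is the pair of its vertex set and its face set.\<close>

type_synonym 'a complex_pair = "'a set \<times> 'a set set"

definition divisor_vertices ::
    "'a::ring_1_no_zero_divisors set \<Rightarrow> 'a \<Rightarrow> 'a set" where
  "divisor_vertices R x = {y \<in> R. divides y x}"

text \<open>
  A list \<open>ys\<close> of distinct vertices is a set of vertices together with the order in which they are
  multiplied, so the existential over \<open>ys\<close> includes the choice of the permutation.
\<close>

definition divisor_faces ::
    "'a::ring_1_no_zero_divisors set \<Rightarrow> 'a \<Rightarrow> 'a set set" where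
  "divisor_faces R x =
     insert {} {set ys | ys. distinct ys \<and> set ys \<subseteq> divisor_vertices R x \<and>
                             divides (prod_list ys) x}"

definition divisor_complex ::
    "'a::ring_1_no_zero_divisors set \<Rightarrow> 'a \<Rightarrow> 'a complex_pair" where
  "divisor_complex R x = (divisor_vertices R x, divisor_faces R x)"

definition complex_join ::
    "'a complex_pair \<Rightarrow> 'a complex_pair \<Rightarrow> 'a complex_pair" where
  "complex_join S T = (fst S \<union> fst T, {A \<union> B | A B. A \<in> snd S \<and> B \<in> snd T})"

end

theory Submission
  imports Defs
begin

text \<open>
  Normal elements are closed under products, so in an n-atomic domain every element is normal:
  the domain is duo, and divisibility and association become one-sided.  Both conditions of the
  theorem are equivalent to all irreducibles being prime.  The key consequence of primeness is
  commutativity up to units: writing \<open>q * p = p * q'\<close>, primeness of \<open>q\<close> makes \<open>q\<close> associated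
  with \<open>p\<close> or with \<open>q'\<close>, and either way \<open>q * p = p * q * u\<close> with a unit \<open>u\<close>.  After that the usual
  commutative arguments apply.
\<close>

section \<open>Units, irreducibles, normal elements and two-sided divisibility\<close>

text \<open>From \<open>a * b = 1\<close> one gets \<open>a * (b * a - 1) = 0\<close> with
  \<open>a\<close> nonzero, so the absence of zero divisors finishes. Hence a one-sided inverse
  suffices to certify a unit.\<close>

lemma right_inverse_imp_left_inverse:
  fixes a b :: "'a::ring_1_no_zero_divisors"
  assumes "a * b = 1"
  shows "b * a = 1"
proof -
  have "a * (b * a - 1) = 0"
    using assms by (simp add: right_diff_distrib flip: mult.assoc)
  then show ?thesis
    using assms by auto
qed

lemma unit_groupI:
  fixes a b :: "'a::ring_1_no_zero_divisors"
  shows "a * b = 1 \<Longrightarrow> a \<in> unit_group" "a * b = 1 \<Longrightarrow> b \<in> unit_group"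
  unfolding unit_group_def using right_inverse_imp_left_inverse by blast+

lemma unit_groupE:
  assumes "u \<in> unit_group"
  obtains v where "v \<in> unit_group" "u * v = 1" "v * u = 1"
  using assms unfolding unit_group_def by blast

lemma one_in_unit_group [simp]: "1 \<in> unit_group"
  by (auto simp: unit_group_def)

lemma zero_notin_unit_group [simp]: "0 \<notin> unit_group"
  by (auto simp: unit_group_def)

lemma mult_in_unit_group_iff:
  fixes a b :: "'a::ring_1_no_zero_divisors"
  shows "a * b \<in> unit_group \<longleftrightarrow> a \<in> unit_group \<and> b \<in> unit_group"
proof
  assume "a * b \<in> unit_group"
  then obtain v where "a * b * v = 1" "v * (a * b) = 1"
    by (rule unit_groupE)
  then show "a \<in> unit_group \<and> b \<in> unit_group"
    using unit_groupI(1)[of a "b * v"] unit_groupI(2)[of "v * a" b] by (simp add: mult.assoc)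
next
  assume "a \<in> unit_group \<and> b \<in> unit_group"
  then obtain v w where "a * v = 1" "b * w = 1"
    by (meson unit_groupE)
  then have "a * b * (w * v) = 1"
    by (metis mult.assoc mult_1_right)
  then show "a * b \<in> unit_group"
    by (rule unit_groupI)
qed

lemma nonzero_nonunits_iff: "a \<in> nonzero_nonunits \<longleftrightarrow> a \<noteq> 0 \<and> a \<notin> unit_group"
  by (auto simp: nonzero_nonunits_def)

lemma mult_in_nonzero_nonunits:
  "a \<in> nonzero_nonunits \<Longrightarrow> b \<in> nonzero_nonunits \<Longrightarrow> a * b \<in> nonzero_nonunits"
  by (simp add: nonzero_nonunits_iff mult_in_unit_group_iff)

lemma irreducible_nonzero: "p \<in> irreducibles \<Longrightarrow> p \<noteq> 0"
  and irreducible_nonunit: "p \<in> irreducibles \<Longrightarrow> p \<notin> unit_group"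
  by (simp_all add: irreducibles_def nonzero_nonunits_iff)

lemma irreducible_multD:
  "a * b \<in> irreducibles \<Longrightarrow> a \<in> unit_group \<or> b \<in> unit_group"
  by (auto simp: irreducibles_def)

lemma irreducible_mult_unit:
  assumes "p \<in> irreducibles" "u \<in> unit_group"
  shows "p * u \<in> irreducibles"
proof -
  obtain v where v: "v \<in> unit_group" "u * v = 1" "v * u = 1"
    using assms(2) by (rule unit_groupE)
  have "b \<in> unit_group \<or> c \<in> unit_group" if "p * u = b * c" for b c
  proof -
    have "p = b * (c * v)"
      using v(2) that by (metis mult.assoc mult_1_right)
    then show ?thesis
      using assms(1) irreducible_multD mult_in_unit_group_iff by metis
  qed
  moreover have "p * u \<noteq> 0" "p * u \<notin> unit_group"
    using assms by (auto simp: mult_in_unit_group_iff irreducible_nonzero irreducible_nonunit)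
  ultimately show ?thesis
    by (auto simp: irreducibles_def nonzero_nonunits_iff)
qed

lemma normal_element_iff:
  "normal_element a \<longleftrightarrow> (\<forall>d. \<exists>e. a * d = e * a) \<and> (\<forall>d. \<exists>e. d * a = a * e)"
  unfolding normal_element_def by (simp add: set_eq_iff image_iff) metis

lemma normal_element_mult:
  fixes a b :: "'a::ring_1_no_zero_divisors"
  assumes "normal_element a" "normal_element b"
  shows "normal_element (a * b)"
proof -
  have a: "\<exists>e. a * d = e * a" "\<exists>e. d * a = a * e" for d
    using assms(1) unfolding normal_element_iff by blast+
  have b: "\<exists>e. b * d = e * b" "\<exists>e. d * b = b * e" for d
    using assms(2) unfolding normal_element_iff by blast+
  have "\<exists>e. a * b * d = e * (a * b)" "\<exists>e. d * (a * b) = a * b * e" for d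
    using a b by (metis mult.assoc)+
  then show ?thesis
    unfolding normal_element_iff by blast
qed

lemma normal_element_unit:
  assumes "u \<in> unit_group"
  shows "normal_element u"
proof -
  obtain v where v: "u * v = 1" "v * u = 1"
    using assms by (rule unit_groupE)
  have "u * d = (u * d * v) * u" "d * u = u * (v * d * u)" for d
    using v by (metis mult.assoc mult_1_left mult_1_right)+
  then show ?thesis
    unfolding normal_element_iff by blast
qed

lemma n_atomic_normal_element:
  fixes a :: "'a::ring_1_no_zero_divisors"
  assumes "n_atomic TYPE('a)"
  shows "normal_element a"
proof -
  have prod: "normal_element (prod_list xs)" if "set xs \<subseteq> normal_irreducibles" for xs :: "'a list"
    using that
    by (induction xs) (auto simp: normal_element_unit normal_irreducibles_def
        intro: normal_element_mult)
  \<comment> \<open>Atomicity only speaks about nonzero nonunits; zero and units are normal for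
    trivial reasons.\<close>
  consider "a = 0" | "a \<in> unit_group" | "a \<in> nonzero_nonunits"
    by (auto simp: nonzero_nonunits_iff)
  then show ?thesis
  proof cases
    case 1
    then show ?thesis by (auto simp: normal_element_def)
  next
    case 2
    then show ?thesis by (rule normal_element_unit)
  next
    case 3
    then show ?thesis
      using assms prod unfolding n_atomic_def by metis
  qed
qed

lemma divides_refl [simp]: "divides a a"
  unfolding divides_def by (metis mult_1_left mult_1_right)

lemma divides_multI: "divides p a \<Longrightarrow> divides p (c * a * d)"
  unfolding divides_def by (metis mult.assoc)

lemma divides_mult_left: "divides p a \<Longrightarrow> divides p (c * a)"
  using divides_multI[of p a c 1] by simp

lemma divides_mult_right: "divides p a \<Longrightarrow> divides p (a * d)"
  using divides_multI[of p a 1 d] by simp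

lemma divides_unit_mult_left:
  assumes "u \<in> unit_group" "divides p (u * a)"
  shows "divides p a"
proof -
  obtain v where "v * u = 1"
    using assms(1) by (rule unit_groupE)
  then have "a = v * (u * a)"
    by (simp flip: mult.assoc)
  then show ?thesis
    using divides_mult_left[OF assms(2), of v] by simp
qed

lemma divides_mult_unit_right:
  assumes "u \<in> unit_group" "divides p (a * u)"
  shows "divides p a"
proof -
  obtain v where "u * v = 1"
    using assms(1) by (rule unit_groupE)
  then have "a = (a * u) * v"
    by (simp add: mult.assoc)
  then show ?thesis
    using divides_mult_right[OF assms(2), of v] by simp
qed

text \<open>Reduces the proofs of primeness to two nonzero nonunits, the range in which
  factorizations and the join condition are available. If a factor is zero, \<open>p\<close> divides
  it; if a factor is a unit, it can be stripped off.\<close>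

lemma divides_mult_cases:
  assumes "divides p (a * b)"
  obtains "divides p a" | "divides p b" | "a \<in> nonzero_nonunits" "b \<in> nonzero_nonunits"
proof -
  have "divides p 0"
    unfolding divides_def by (metis mult_zero_right)
  then show ?thesis
    using assms that divides_unit_mult_left divides_mult_unit_right
    unfolding nonzero_nonunits_iff by metis
qed

lemma divides_prod_list:
  assumes "x \<in> set xs"
  shows "divides x (prod_list xs)"
proof -
  obtain ys zs where "xs = ys @ x # zs"
    using assms by (meson split_list)
  then have "prod_list xs = prod_list ys * x * prod_list zs"
    by (simp add: mult.assoc)
  then show ?thesis
    unfolding divides_def by blast
qed

section \<open>Duo domains\<close>

locale duo_domain =
  fixes type :: "'a::ring_1_no_zero_divisors itself"
  assumes normal: "normal_element (a :: 'a)"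
begin

lemma commute_right:
  fixes a d :: 'a
  obtains e where "d * a = a * e"
  using normal[of a] unfolding normal_element_iff by blast

lemma divides_iff:
  fixes a b :: 'a
  shows "divides a b \<longleftrightarrow> (\<exists>c. b = a * c)"
proof
  assume "divides a b"
  then obtain c d where "b = c * a * d"
    by (auto simp: divides_def)
  moreover obtain e where "c * a = a * e"
    by (rule commute_right)
  ultimately show "\<exists>c. b = a * c"
    by (metis mult.assoc)
qed (metis divides_def mult_1_left)

text \<open>Moving \<open>u\<close> and its inverse past \<open>a\<close> gives \<open>v\<close> and
  \<open>w\<close> with \<open>a * (v * w) = a\<close>; cancelling \<open>a\<close> shows that
  \<open>v\<close> is a unit.\<close>

lemma unit_commute:
  fixes a u :: 'a
  assumes "u \<in> unit_group"
  obtains v where "v \<in> unit_group" "u * a = a * v"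
proof (cases "a = 0")
  case True
  then show ?thesis using that[of 1] by simp
next
  case False
  obtain u' where u': "u * u' = 1"
    using assms by (rule unit_groupE)
  obtain v where v: "u * a = a * v" by (rule commute_right)
  obtain w where w: "u' * a = a * w" by (rule commute_right)
  have "a * (v * w) = a * 1"
    using u' v w by (metis mult.assoc mult_1_left mult_1_right)
  then have "v * w = 1"
    using False by (metis mult_left_cancel)
  then show ?thesis
    using that unit_groupI(1) v by blast
qed

lemma associates_iff:
  fixes a b :: 'a
  shows "associates a b \<longleftrightarrow> (\<exists>u\<in>unit_group. a = b * u)"
proof
  assume "associates a b"
  then obtain u v where "u \<in> unit_group" "v \<in> unit_group" "a = v * b * u"
    by (auto simp: associates_def)
  moreover obtain w where "w \<in> unit_group" "v * b = b * w"
    using unit_commute calculation(2) by blast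
  ultimately show "\<exists>u\<in>unit_group. a = b * u"
    by (metis mult.assoc mult_in_unit_group_iff)
qed (metis associates_def mult_1_left one_in_unit_group)

lemma associates_refl: "associates (a :: 'a) a"
  unfolding associates_iff by (metis mult_1_right one_in_unit_group)

lemma associates_sym: "associates (a :: 'a) b \<Longrightarrow> associates b a"
  unfolding associates_iff by (metis mult.assoc mult_1_right unit_groupE)

lemma associates_trans: "associates (a :: 'a) b \<Longrightarrow> associates b c \<Longrightarrow> associates a c"
  unfolding associates_iff by (metis mult.assoc mult_in_unit_group_iff)

lemma associates_mult_left: "associates (a :: 'a) b \<Longrightarrow> associates (c * a) (c * b)"
  unfolding associates_iff by (metis mult.assoc)

lemma associates_mult_right:
  fixes a b c :: 'a
  assumes "associates a b"
  shows "associates (a * c) (b * c)"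
proof -
  obtain u where u: "u \<in> unit_group" "a = b * u"
    using assms by (auto simp: associates_iff)
  obtain v where "v \<in> unit_group" "u * c = c * v"
    using unit_commute u(1) by blast
  then show ?thesis
    using u(2) unfolding associates_iff by (metis mult.assoc)
qed

lemma associates_cancel_left:
  fixes a b c :: 'a
  assumes "c \<noteq> 0" "associates (c * a) (c * b)"
  shows "associates a b"
  using assms unfolding associates_iff by (metis mult.assoc mult_left_cancel)

lemma divides_associates_cong:
  fixes a b p q :: 'a
  assumes "associates p q" "associates a b" "divides p a"
  shows "divides q b"
  using assms(3) assms(1)[THEN associates_sym] assms(2)[THEN associates_sym]
  unfolding divides_iff associates_iff by (metis assms(1) associates_iff mult.assoc)

lemma divides_trans: "divides (a :: 'a) b \<Longrightarrow> divides b c \<Longrightarrow> divides a c"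
  unfolding divides_iff by (metis mult.assoc)

lemma divides_mult_mono:
  fixes a b c d :: 'a
  assumes "divides a b" "divides c d"
  shows "divides (a * c) (b * d)"
proof -
  obtain x y where "b = a * x" "d = c * y"
    using assms by (auto simp: divides_iff)
  \<comment> \<open>The cofactor \<open>x\<close> stands between \<open>a\<close> and
    \<open>c\<close> and has to be moved to the right of \<open>c\<close>.\<close>
  moreover obtain e where "x * c = c * e"
    by (rule commute_right)
  ultimately have "b * d = a * c * (e * y)"
    by (metis mult.assoc)
  then show ?thesis
    by (auto simp: divides_iff)
qed

lemma divides_prod_list_filter:
  fixes xs :: "'a list"
  shows "divides (prod_list (filter P xs)) (prod_list xs)"
proof (induction xs)
  case Nil
  then show ?case by (simp add: divides_iff)
next
  case (Cons x xs)
  then show ?case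
    using divides_mult_mono divides_mult_left by auto
qed

lemma divides_irreducible_imp_associates:
  fixes p q :: 'a
  assumes "p \<notin> unit_group" "q \<in> irreducibles" "divides p q"
  shows "associates q p"
  using assms irreducible_multD unfolding divides_iff associates_iff by blast

text \<open>One inclusion of the join equality holds in every duo domain, because divisibilities can
  be multiplied.\<close>

lemma faces_join_subset:
  fixes a b :: 'a
  assumes "A \<in> divisor_faces R a" "B \<in> divisor_faces R b"
  shows "A \<union> B \<in> divisor_faces R (a * b)"
proof -
  have list: "\<exists>ys. C = set ys \<and> distinct ys \<and> set ys \<subseteq> divisor_vertices R c \<and>
      divides (prod_list ys) c" if "C \<in> divisor_faces R c" for C and c :: 'a
    using that unfolding divisor_faces_def
    \<comment> \<open>The empty face comes from the empty list, whose product 1 divides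
      everything.\<close>
    by (auto simp: divides_iff intro: exI[of _ "[]"])
  obtain ys where ys: "A = set ys" "distinct ys" "set ys \<subseteq> divisor_vertices R a"
    "divides (prod_list ys) a"
    using list[OF assms(1)] by blast
  obtain zs where zs: "B = set zs" "distinct zs" "set zs \<subseteq> divisor_vertices R b"
    "divides (prod_list zs) b"
    using list[OF assms(2)] by blast
  \<comment> \<open>A common vertex may occur only once in the list of a face, so its copy in
    \<open>zs\<close> is dropped; the product of the remaining entries still divides
    \<open>b\<close>.\<close>
  define ws where "ws = ys @ filter (\<lambda>z. z \<notin> set ys) zs"
  have "divides (prod_list ws) (a * b)"
    unfolding ws_def prod_list.append
    using ys(4) divides_trans[OF divides_prod_list_filter zs(4)] by (rule divides_mult_mono)
  moreover have "A \<union> B = set ws" "distinct ws"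
    using ys zs by (auto simp: ws_def)
  moreover have "set ws \<subseteq> divisor_vertices R (a * b)"
    using ys(3) zs(3)
    by (auto simp: ws_def divisor_vertices_def intro: divides_mult_left divides_mult_right)
  ultimately show ?thesis
    unfolding divisor_faces_def by blast
qed

end

section \<open>Domains with prime irreducibles\<close>

locale prime_duo_domain = duo_domain type for type :: "'a::ring_1_no_zero_divisors itself" +
  assumes prime: "p \<in> irreducibles \<Longrightarrow> divides p (a * b) \<Longrightarrow> divides p a \<or> divides p (b :: 'a)"
begin

lemma irreducible_commute:
  fixes p q :: 'a
  assumes p: "p \<in> irreducibles" and q: "q \<in> irreducibles"
  shows "associates (q * p) (p * q)"
proof -
  obtain q' where q': "q * p = p * q'"
    by (rule commute_right)
  then have "divides q (p * q')"
    by (metis divides_iff)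
  then consider "divides q p" | "divides q q'"
    using prime q by blast
  then show ?thesis
  proof cases
    case 1
    \<comment> \<open>Both \<open>q * p\<close> and \<open>p * q\<close> are then associated with
      \<open>q * q\<close>.\<close>
    then have "associates p q"
      using divides_irreducible_imp_associates irreducible_nonunit p q by blast
    then show ?thesis
      using associates_mult_left associates_mult_right associates_sym associates_trans by metis
  next
    case 2
    then obtain u where u: "q' = q * u"
      by (auto simp: divides_iff)
    \<comment> \<open>Passing \<open>u\<close> and \<open>q\<close> to the left of \<open>p\<close>
      gives \<open>q * p = p * q * u = f * p * u = f * e * p\<close>. Cancelling \<open>p\<close>
      yields \<open>q = f * e\<close>, so irreducibility of \<open>q\<close> makes \<open>e\<close>
      or \<open>f\<close> a unit.\<close>
    obtain e where e: "p * u = e * p"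
      using normal[of p] unfolding normal_element_iff by blast
    obtain f where f: "p * q = f * p"
      using normal[of p] unfolding normal_element_iff by blast
    have "q = f * e"
      using q' u e f irreducible_nonzero[OF p] by (metis mult.assoc mult_right_cancel)
    then consider "f \<in> unit_group" | "e \<in> unit_group"
      using q irreducible_multD by blast
    then show ?thesis
    proof cases
      case 1
      \<comment> \<open>This case is impossible: \<open>p * q = f * p = p * v\<close> would make
        \<open>q\<close> equal to the unit \<open>v\<close>.\<close>
      then obtain v where "v \<in> unit_group" "f * p = p * v"
        by (rule unit_commute)
      then have "q \<in> unit_group"
        using f irreducible_nonzero[OF p] by (metis mult_left_cancel)
      then show ?thesis
        using q irreducible_nonunit by blast
    next
      case 2
      \<comment> \<open>Here \<open>p * u = e * p = p * v\<close>, so \<open>u\<close> is the unit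
        \<open>v\<close> and \<open>q * p = p * q * u\<close> is the claim.\<close>
      then obtain v where "v \<in> unit_group" "e * p = p * v"
        by (rule unit_commute)
      then have "u \<in> unit_group"
        using e irreducible_nonzero[OF p] by (metis mult_left_cancel)
      then show ?thesis
        using q' u unfolding associates_iff by (metis mult.assoc)
    qed
  qed
qed

lemma prod_list_irreducible_commute:
  fixes p :: 'a
  assumes "p \<in> irreducibles" "set xs \<subseteq> irreducibles"
  shows "associates (prod_list xs * p) (p * prod_list xs)"
  using assms(2)
proof (induction xs)
  case Nil
  then show ?case by (simp add: associates_refl)
next
  case (Cons x xs)
  have "associates (x * (prod_list xs * p)) (x * (p * prod_list xs))"
    using Cons by (auto intro: associates_mult_left)
  moreover have "associates (x * p * prod_list xs) (p * x * prod_list xs)"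
    using Cons.prems assms(1) by (auto intro: associates_mult_right irreducible_commute)
  ultimately show ?case
    using associates_trans by (simp add: mult.assoc)
qed

lemma irreducible_divides_prod_list:
  fixes p :: 'a
  assumes "p \<in> irreducibles" "divides p (prod_list xs)"
  shows "\<exists>x\<in>set xs. divides p x"
  using assms(2)
proof (induction xs)
  case Nil
  then show ?case
    using assms(1) irreducible_nonunit unit_groupI(1)[of p] by (auto simp: divides_iff)
next
  case (Cons x xs)
  then show ?case
    using prime[OF assms(1), of x "prod_list xs"] by auto
qed

text \<open>Uniqueness is phrased with multisets of association classes, from which a permutation
  can be read off later. Assuming association of the products instead of equality lets the induction
  absorb the units created by reordering.\<close>

lemma associates_prod_lists_imp_mset_eq:
  fixes rs ts :: "'a list"
  assumes "set rs \<subseteq> irreducibles" "set ts \<subseteq> irreducibles"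
    and "associates (prod_list rs) (prod_list ts)"
  shows "mset (map (\<lambda>x. Collect (associates x)) rs) =
    mset (map (\<lambda>x. Collect (associates x)) ts)"
  using assms
proof (induction rs arbitrary: ts)
  case Nil
  have "prod_list ts \<in> unit_group"
    using Nil.prems(3) associates_sym unfolding associates_iff by fastforce
  then have "ts = []"
    using Nil.prems(2)
    by (cases ts) (auto simp: mult_in_unit_group_iff irreducible_nonunit)
  then show ?case by simp
next
  case (Cons r rs)
  have r: "r \<in> irreducibles"
    using Cons.prems by simp
  have "divides r (prod_list (r # rs))"
    by (auto simp: divides_iff)
  then have "divides r (prod_list ts)"
    using divides_associates_cong associates_refl Cons.prems(3) by blast
  then obtain t where t: "t \<in> set ts" "divides r t"
    using irreducible_divides_prod_list r by blast
  then have tr: "associates t r"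
    using divides_irreducible_imp_associates r irreducible_nonunit Cons.prems(2) by blast
  obtain xs ys where ts: "ts = xs @ t # ys"
    using t(1) by (meson split_list)
  \<comment> \<open>Bringing \<open>t\<close> to the front costs only a unit, after which
    \<open>t\<close> can be replaced by \<open>r\<close> and cancelled.\<close>
  have "associates (prod_list xs * t) (t * prod_list xs)"
    using Cons.prems(2) ts by (auto intro: prod_list_irreducible_commute)
  then have "associates (prod_list ts) (t * (prod_list xs * prod_list ys))"
    using associates_mult_right ts by (fastforce simp flip: mult.assoc)
  then have "associates (r * prod_list rs) (r * prod_list (xs @ ys))"
    using Cons.prems(3) associates_mult_right[OF tr] associates_trans by fastforce
  then have "associates (prod_list rs) (prod_list (xs @ ys))"
    using associates_cancel_left irreducible_nonzero r by blast
  then have "mset (map (\<lambda>x. Collect (associates x)) rs) =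
      mset (map (\<lambda>x. Collect (associates x)) (xs @ ys))"
    using Cons.prems ts by (intro Cons.IH) auto
  moreover have "Collect (associates r) = Collect (associates t)"
    using tr associates_trans associates_sym by blast
  ultimately show ?case
    using ts by simp
qed

end

section \<open>Each of the two conditions makes irreducibles prime\<close>

locale n_atomic_domain =
  fixes type :: "'a::ring_1_no_zero_divisors itself"
  assumes n_atomic: "n_atomic TYPE('a)"
begin

sublocale duo_domain type
  by unfold_locales (rule n_atomic_normal_element[OF n_atomic])

lemma normal_irreducibles_eq: "(normal_irreducibles :: 'a set) = irreducibles"
  using normal by (auto simp: normal_irreducibles_def)

lemma factorization:
  fixes a :: 'a
  assumes "a \<in> nonzero_nonunits"
  obtains xs where "set xs \<subseteq> irreducibles" "a = prod_list xs"
  using n_atomic assms unfolding n_atomic_def normal_irreducibles_eq by blast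

text \<open>A factorization of \<open>a * b\<close> that starts with \<open>p\<close> is compared
  with the concatenated factorizations of \<open>a\<close> and \<open>b\<close>; the partner of
  \<open>p\<close> divides \<open>a\<close> or \<open>b\<close>.\<close>

lemma n_UFD_imp_prime:
  fixes p a b :: 'a
  assumes "n_UFD TYPE('a)" and p: "p \<in> irreducibles" and "divides p (a * b)"
  shows "divides p a \<or> divides p b"
  using assms(3)
proof (cases rule: divides_mult_cases)
  case 3
  obtain c where c: "a * b = p * c"
    using assms(3) by (auto simp: divides_iff)
  \<comment> \<open>Needed to factor \<open>c\<close>. A unit \<open>c\<close> would make
    \<open>a * b\<close> irreducible although both factors are nonunits.\<close>
  have "c \<notin> unit_group"
  proof
    assume "c \<in> unit_group"
    then have "a * b \<in> irreducibles"
      using c p irreducible_mult_unit by metis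
    then show False
      using 3 irreducible_multD by (auto simp: nonzero_nonunits_iff)
  qed
  moreover have "c \<noteq> 0"
    using 3 c by (auto simp: nonzero_nonunits_iff)
  ultimately obtain zs where zs: "set zs \<subseteq> irreducibles" "c = prod_list zs"
    using factorization[of c] by (auto simp: nonzero_nonunits_iff)
  obtain xs where xs: "set xs \<subseteq> irreducibles" "a = prod_list xs"
    using factorization 3(1) by blast
  obtain ys where ys: "set ys \<subseteq> irreducibles" "b = prod_list ys"
    using factorization 3(2) by blast
  have eq: "prod_list (p # zs) = prod_list (xs @ ys)"
    using c xs ys zs by simp
  have "prod_list (p # zs) \<in> nonzero_nonunits"
    unfolding eq using 3 xs ys mult_in_nonzero_nonunits by auto
  with eq obtain \<sigma> where \<sigma>: "length (p # zs) = length (xs @ ys)"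
    "\<sigma> permutes {..<length (p # zs)}"
    "\<forall>i<length (p # zs). associates ((p # zs) ! i) ((xs @ ys) ! \<sigma> i)"
    using assms(1)[unfolded n_UFD_def normal_irreducibles_eq, THEN conjunct2, rule_format,
        of "p # zs" "xs @ ys"] p xs(1) ys(1) zs(1) by auto
  \<comment> \<open>Index 0 is the position of \<open>p\<close> in \<open>p # zs\<close>, so
    \<open>\<sigma> 0\<close> is the position of its partner.\<close>
  have "\<sigma> 0 < length (xs @ ys)"
    using permutes_in_image[OF \<sigma>(2), of 0] \<sigma>(1) by simp
  then obtain q where q: "q \<in> set xs \<union> set ys" "associates p q"
    using \<sigma>(3) nth_mem[of "\<sigma> 0" "xs @ ys"] by force
  have "divides p q"
    using q(2) associates_sym by (auto simp: associates_iff divides_iff)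
  then show ?thesis
    using q(1) xs ys divides_trans divides_prod_list by blast
qed auto

lemma representative:
  fixes p :: 'a
  assumes "irreducible_representatives R" "p \<in> irreducibles"
  obtains y where "y \<in> R" "associates y p"
proof -
  have "(\<lambda>u. p * u) ` unit_group \<in> irreducible_cosets"
    using assms(2) by (auto simp: irreducible_cosets_def)
  then obtain y where "y \<in> R" "y \<in> (\<lambda>u. p * u) ` unit_group"
    using assms(1) unfolding irreducible_representatives_def by blast
  then show ?thesis
    using that unfolding associates_iff by blast
qed

text \<open>The representative of \<open>p\<close> is a vertex of the complex of
  \<open>a * b\<close>, hence of the complex of \<open>a\<close> or of \<open>b\<close>;
  divisibility passes back to \<open>p\<close> by association.\<close>

lemma divisor_vertices_eq_imp_prime:
  fixes p a b :: 'a
  assumes R: "irreducible_representatives R"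
    and vertices: "\<And>a b :: 'a. a \<in> nonzero_nonunits \<Longrightarrow> b \<in> nonzero_nonunits \<Longrightarrow>
      divisor_vertices R a \<union> divisor_vertices R b = divisor_vertices R (a * b)"
    and p: "p \<in> irreducibles" and "divides p (a * b)"
  shows "divides p a \<or> divides p b"
  using assms(4)
proof (cases rule: divides_mult_cases)
  case 3
  obtain y where y: "y \<in> R" "associates y p"
    using representative R p by blast
  then have "y \<in> divisor_vertices R (a * b)"
    using assms(4) divides_associates_cong associates_sym associates_refl
    unfolding divisor_vertices_def by blast
  then have "divides y a \<or> divides y b"
    using vertices[OF 3] unfolding divisor_vertices_def by blast
  then show ?thesis
    using y(2) divides_associates_cong associates_refl by blast
qed auto

end

section \<open>Prime irreducibles give unique factorization and the join formula\<close>

locale n_atomic_prime_domain = n_atomic_domain type + prime_duo_domain type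
  for type :: "'a::ring_1_no_zero_divisors itself"
begin

lemma n_UFD: "n_UFD TYPE('a)"
  unfolding n_UFD_def normal_irreducibles_eq
proof (intro conjI allI impI n_atomic)
  fix rs ts :: "'a list"
  assume "set rs \<subseteq> irreducibles" "set ts \<subseteq> irreducibles" "prod_list rs = prod_list ts"
  then have m: "mset (map (\<lambda>x. Collect (associates x)) rs) =
      mset (map (\<lambda>x. Collect (associates x)) ts)"
    using associates_prod_lists_imp_mset_eq associates_refl by metis
  then show len: "length rs = length ts"
    by (metis length_map mset_eq_length)
  obtain \<sigma> where \<sigma>: "\<sigma> permutes {..<length ts}"
    "permute_list \<sigma> (map (\<lambda>x. Collect (associates x)) ts) =
      map (\<lambda>x. Collect (associates x)) rs"
    using mset_eq_permutation[OF m] by auto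
  have "associates (rs ! i) (ts ! \<sigma> i)" if "i < length rs" for i
  proof -
    have "\<sigma> i < length ts"
      using permutes_in_image[OF \<sigma>(1), of i] that len by simp
    then have "Collect (associates (rs ! i)) = Collect (associates (ts ! \<sigma> i))"
      using permute_list_nth[of \<sigma> "map (\<lambda>x. Collect (associates x)) ts" i] \<sigma> that len by simp
    \<comment> \<open>Since \<open>ts ! \<sigma> i\<close> lies in its own class, it lies in the
      class of \<open>rs ! i\<close>.\<close>
    then show ?thesis
      using associates_refl by blast
  qed
  then show "\<exists>\<sigma>. \<sigma> permutes {..<length rs} \<and>
      (\<forall>i<length rs. associates (rs ! i) (ts ! \<sigma> i))"
    using \<sigma>(1) len by auto
qed

lemma commute_irreducible:
  fixes a p :: 'a
  assumes "a \<noteq> 0" "p \<in> irreducibles"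
  shows "associates (a * p) (p * a)"
proof (cases "a \<in> unit_group")
  case True
  then obtain v where v: "v \<in> unit_group" "a * p = p * v"
    by (rule unit_commute)
  obtain w where "w \<in> unit_group" "a * w = 1"
    using True by (rule unit_groupE)
  \<comment> \<open>With \<open>w\<close> the inverse of \<open>a\<close>, this rewrites
    \<open>a * p = p * v\<close> as \<open>p * a\<close> times the unit
    \<open>w * v\<close>.\<close>
  then have "v = a * (w * v)" "w * v \<in> unit_group"
    using v(1) by (simp_all add: mult_in_unit_group_iff flip: mult.assoc)
  then show ?thesis
    using v(2) unfolding associates_iff by (metis mult.assoc)
next
  case False
  then show ?thesis
    using assms factorization[of a] prod_list_irreducible_commute
    by (metis nonzero_nonunits_iff)
qed

text \<open>This carries the harder inclusion of the join equality. By primeness the first entry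
  \<open>y\<close> divides \<open>a\<close> or \<open>b\<close>; it is cancelled there and the rest
  is split by induction, with \<open>a\<close> and \<open>b\<close> varying.\<close>

lemma divides_mult_split:
  fixes a b :: 'a
  assumes "a \<noteq> 0" "b \<noteq> 0" "set ys \<subseteq> irreducibles" "distinct ys"
    and "divides (prod_list ys) (a * b)"
  shows "\<exists>as bs. distinct as \<and> distinct bs \<and> set as \<union> set bs = set ys \<and>
    divides (prod_list as) a \<and> divides (prod_list bs) b"
  using assms
proof (induction ys arbitrary: a b)
  case Nil
  then show ?case by (auto simp: divides_iff)
next
  case (Cons y ys)
  have y: "y \<in> irreducibles" "y \<noteq> 0"
    using Cons.prems(3) irreducible_nonzero by auto
  obtain c where c: "a * b = y * (prod_list ys * c)"
    using Cons.prems(5) by (auto simp: divides_iff mult.assoc)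
  then have "divides y (a * b)"
    by (auto simp: divides_iff)
  then consider "divides y a" | "divides y b"
    using prime y(1) by blast
  then show ?case
  proof cases
    case 1
    then obtain a' where a': "a = y * a'"
      by (auto simp: divides_iff)
    then have "a' * b = prod_list ys * c"
      using c y(2) by (metis mult.assoc mult_left_cancel)
    then have "divides (prod_list ys) (a' * b)"
      unfolding divides_iff by blast
    then obtain as bs where split: "distinct as" "distinct bs" "set as \<union> set bs = set ys"
      "divides (prod_list as) a'" "divides (prod_list bs) b"
      using Cons.IH[of a' b] Cons.prems(1-4) a' by auto
    then have "distinct (y # as)" "set (y # as) \<union> set bs = set (y # ys)"
      using Cons.prems(4) by auto
    moreover have "divides (prod_list (y # as)) a"
      using a' split(4) by (simp add: divides_mult_mono)
    ultimately show ?thesis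
      using split(2,5) by blast
  next
    case 2
    then obtain b' where b': "b = y * b'"
      by (auto simp: divides_iff)
    \<comment> \<open>To cancel \<open>y\<close> on the left it must first pass \<open>a\<close>.
      The resulting unit \<open>u\<close> is merged into the second factor, so the induction
      hypothesis is applied to \<open>a\<close> and \<open>u * b'\<close>, and \<open>u\<close> is
      discarded afterwards.\<close>
    obtain u where u: "u \<in> unit_group" "a * y = y * a * u"
      using commute_irreducible Cons.prems(1) y(1) by (auto simp: associates_iff)
    have "y * (a * (u * b')) = y * (prod_list ys * c)"
      using c b' u by (metis mult.assoc)
    then have "a * (u * b') = prod_list ys * c"
      using y(2) by (metis mult_left_cancel)
    then have "divides (prod_list ys) (a * (u * b'))"
      unfolding divides_iff by blast
    moreover have "u * b' \<noteq> 0"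
      using u(1) b' Cons.prems(2) by auto
    ultimately obtain as bs where split: "distinct as" "distinct bs" "set as \<union> set bs = set ys"
      "divides (prod_list as) a" "divides (prod_list bs) (u * b')"
      using Cons.IH[of a "u * b'"] Cons.prems(1,3,4) by auto
    then have "distinct (y # bs)" "set as \<union> set (y # bs) = set (y # ys)"
      using Cons.prems(4) by auto
    moreover have "divides (prod_list (y # bs)) b"
      using b' divides_unit_mult_left[OF u(1) split(5)] by (simp add: divides_mult_mono)
    ultimately show ?thesis
      using split(1,4) by blast
  qed
qed

lemma complex_join_eq:
  fixes a b :: 'a
  assumes R: "irreducible_representatives R"
    and ab: "a \<in> nonzero_nonunits" "b \<in> nonzero_nonunits"
  shows "complex_join (divisor_complex R a) (divisor_complex R b) = divisor_complex R (a * b)"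
proof -
  have "R \<subseteq> irreducibles"
    using R irreducible_mult_unit
    unfolding irreducible_representatives_def irreducible_cosets_def by blast
  then have "divisor_vertices R a \<union> divisor_vertices R b = divisor_vertices R (a * b)"
    using prime by (auto simp: divisor_vertices_def intro: divides_mult_left divides_mult_right)
  moreover have "C \<in> {A \<union> B |A B. A \<in> divisor_faces R a \<and> B \<in> divisor_faces R b}"
    if C: "C \<in> divisor_faces R (a * b)" for C
  proof (cases "C = {}")
    case True
    then show ?thesis by (auto simp: divisor_faces_def)
  next
    case False
    then obtain ys where ys: "C = set ys" "distinct ys"
      "set ys \<subseteq> R" "divides (prod_list ys) (a * b)"
      using C by (auto simp: divisor_faces_def divisor_vertices_def)
    then obtain as bs where split: "distinct as" "distinct bs" "set as \<union> set bs = set ys"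
      "divides (prod_list as) a" "divides (prod_list bs) b"
      using divides_mult_split[of a b ys] ab \<open>R \<subseteq> irreducibles\<close>
      by (auto simp: nonzero_nonunits_iff)
    \<comment> \<open>The condition that all entries are vertices is automatic: each entry divides
      the product, which divides \<open>c\<close>.\<close>
    have "set xs \<in> divisor_faces R c"
      if "distinct xs" "set xs \<subseteq> R" "divides (prod_list xs) c" for xs and c :: 'a
    proof -
      have "set xs \<subseteq> divisor_vertices R c"
        using that divides_prod_list divides_trans unfolding divisor_vertices_def by blast
      then show ?thesis
        using that unfolding divisor_faces_def by blast
    qed
    then have "set as \<in> divisor_faces R a" "set bs \<in> divisor_faces R b"
      using split ys(3) by auto
    then show ?thesis
      using split(3) ys(1) by blast
  qed
  then have "{A \<union> B |A B. A \<in> divisor_faces R a \<and> B \<in> divisor_faces R b} =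
      divisor_faces R (a * b)"
    using faces_join_subset[of _ R a _ b] by (intro equalityI subsetI) auto
  ultimately show ?thesis
    by (simp add: complex_join_def divisor_complex_def)
qed

end

theorem theorem13:
  fixes R :: "'a::ring_1_no_zero_divisors set"
  assumes "n_atomic TYPE('a)"
    and "irreducible_representatives R"
  shows "n_UFD TYPE('a) \<longleftrightarrow>
    (\<forall>a\<in>nonzero_nonunits. \<forall>b\<in>nonzero_nonunits.
       complex_join (divisor_complex R a) (divisor_complex R b) = divisor_complex R (a * b))"
    (is "_ \<longleftrightarrow> ?join")
proof -
  interpret n_atomic_domain "TYPE('a)"
    by unfold_locales (rule assms(1))
  show ?thesis
  proof
    assume "n_UFD TYPE('a)"
    \<comment> \<open>Both directions pass through primeness: the condition at hand yields the
      locale, and the locale yields the other condition.\<close>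
    then interpret n_atomic_prime_domain "TYPE('a)"
      by unfold_locales (rule n_UFD_imp_prime)
    show ?join
      using complex_join_eq assms(2) by blast
  next
    assume ?join
    then have "divisor_vertices R a \<union> divisor_vertices R b = divisor_vertices R (a * b)"
      if "a \<in> nonzero_nonunits" "b \<in> nonzero_nonunits" for a b
      using that by (simp add: complex_join_def divisor_complex_def)
    then interpret n_atomic_prime_domain "TYPE('a)"
      by unfold_locales (rule divisor_vertices_eq_imp_prime[OF assms(2)])
    show "n_UFD TYPE('a)"
      by (rule n_UFD)
  qed
qed

end
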